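(* Let $R$ be a topological ring and let $\mathcal B$ be a bornology on $R$ such that $R$ is locally $\mathcal B$-bounded. Then the $\mathcal B$-modification $X^{\sharp\mathcal B}$ of any semitopological $R$-module $X$ is a topological $R$-module.
   Context: A topological ring is a unital ring (not necessarily commutative) with a Hausdorff topology making addition and multiplication jointly continuous. A semitopological (resp. topological) $R$-module is a unital left $R$-module $X$ endowed with a Hausdorff topology making $X$ an Abelian topological group and making the multiplication $*:R\times X\to X$ separately (resp. jointly) continuous. A subset $B\subseteq R$ is bounded if for any neighborhood $U\subseteq R$ of zero there is a neighborhood $V\subseteq R$ of zero with $B\cdot V\subseteq U$. A bornology on $R$ is a family $\mathcal B$ of bounded subsets of $R$ such that: (1) any subset of a set in $\mathcal B$ is in $\mathcal B$; (2) $A\cup B\in\mathcal B$ for $A,B\in\mathcal B$; (3) $B\cdot r\in\mathcal B$ for $B\in\mathcal B$, $r\in R$; (4) $\bigcup\mathcal B=R$. The ring $R$ is locally $\mathcal B$-bounded if for any $B\in\mathcal B$ there is a neighborhood $V\subseteq R$ of zero such that $BV\in\mathcal B$. For subsets $A,B$ of $X$ write $A\Subset B$ if $A+U\subseteq B$ for some neighborhood $U$ of zero in $X$. For $U\subseteq X$ and $B\subseteq R$ put $U/B=\{x\in U: B*x\Subset U\}$. Let $\tau^{\sharp\mathcal B}$ be the family of all sets $W\subseteq X$ such that for every $w\in W$ there exist a neighborhood $U$ of zero in $X$ and a set $B\in\mathcal B$ with $w+U/B\subseteq W$. This is a translation-invariant topology on $X$ containing the original topology. The $R$-module $X$ endowed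 with $\tau^{\sharp\mathcal B}$ is denoted $X^{\sharp\mathcal B}$ and called the $\mathcal B$-modification of $X$. *)

theory Defs
  imports "HOL-Analysis.Analysis"
begin

text \<open>
  Sums and products of subsets are those of \<^theory>\<open>HOL-Library.Set_Algebras\<close>.
  The sort \<open>ring + monoid_mult\<close> describes unital, not necessarily commutative rings; unlike
  \<^class>\<open>ring_1\<close> it does not exclude the zero ring.
\<close>

class topological_ring =
  ring + monoid_mult + t2_space + topological_monoid_add + topological_semigroup_mult

text \<open>The library locale \<open>module\<close> requires a commutative ring of scalars.\<close>

locale left_module =
  fixes act :: "'r::{ring,monoid_mult} \<Rightarrow> 'x::ab_group_add \<Rightarrow> 'x"
  assumes act_right_distrib: "act r (x + y) = act r x + act r y"
    and act_left_distrib: "act (r + s) x = act r x + act s x"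
    and act_act: "act r (act s x) = act (r * s) x"
    and act_one: "act 1 x = x"

text \<open>
  The same module is considered with two topologies, so the topology of a module is a value of
  type \<^typ>\<open>'x topology\<close> rather than part of the type of its elements.
\<close>

locale topological_abelian_group =
  fixes T :: "'x::ab_group_add topology"
  assumes topspace_UNIV: "topspace T = UNIV"
    and continuous_plus: "continuous_map (prod_topology T T) T (\<lambda>(x, y). x + y)"
    and continuous_uminus: "continuous_map T T uminus"

locale semitopological_module = left_module act + topological_abelian_group T
  for T :: "'x::ab_group_add topology" and act :: "'r::topological_ring \<Rightarrow> 'x \<Rightarrow> 'x" +
  assumes Hausdorff: "Hausdorff_space T"
    and continuous_act_left: "\<And>x. continuous_map euclidean T (\<lambda>r. act r x)"
    and continuous_act_right: "\<And>r. continuous_map T T (act r)"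

locale topological_module = left_module act + topological_abelian_group T
  for T :: "'x::ab_group_add topology" and act :: "'r::topological_ring \<Rightarrow> 'x \<Rightarrow> 'x" +
  assumes Hausdorff: "Hausdorff_space T"
    and continuous_act: "continuous_map (prod_topology euclidean T) T (\<lambda>(r, x). act r x)"

text \<open>Neighborhoods are not required to be open.\<close>

definition zero_nbhd :: "'a::zero topology \<Rightarrow> 'a set \<Rightarrow> bool" where
  "zero_nbhd T U \<longleftrightarrow> (\<exists>G. openin T G \<and> 0 \<in> G \<and> G \<subseteq> U)"

definition ring_bounded :: "'r::topological_ring set \<Rightarrow> bool" where
  "ring_bounded B \<longleftrightarrow> (\<forall>U. zero_nbhd euclidean U \<longrightarrow> (\<exists>V. zero_nbhd euclidean V \<and> B * V \<subseteq> U))"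

locale ring_bornology =
  fixes \<B> :: "'r::topological_ring set set"
  assumes bounded: "B \<in> \<B> \<Longrightarrow> ring_bounded B"
    and subset_closed: "B \<in> \<B> \<Longrightarrow> A \<subseteq> B \<Longrightarrow> A \<in> \<B>"
    and union_closed: "A \<in> \<B> \<Longrightarrow> B \<in> \<B> \<Longrightarrow> A \<union> B \<in> \<B>"
    and right_mult_closed: "B \<in> \<B> \<Longrightarrow> (\<lambda>b. b * r) ` B \<in> \<B>"
    and covers: "\<Union>\<B> = UNIV"

definition locally_bounded :: "'r::topological_ring set set \<Rightarrow> bool" where
  "locally_bounded \<B> \<longleftrightarrow> (\<forall>B\<in>\<B>. \<exists>V. zero_nbhd euclidean V \<and> B * V \<in> \<B>)"

definition strongly_inside :: "'x::ab_group_add topology \<Rightarrow> 'x set \<Rightarrow> 'x set \<Rightarrow> bool" where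
  "strongly_inside T A B \<longleftrightarrow> (\<exists>U. zero_nbhd T U \<and> A + U \<subseteq> B)"

definition quot ::
  "'x::ab_group_add topology \<Rightarrow> ('r \<Rightarrow> 'x \<Rightarrow> 'x) \<Rightarrow> 'x set \<Rightarrow> 'r set \<Rightarrow> 'x set" where
  "quot T act U B = {x \<in> U. strongly_inside T ((\<lambda>b. act b x) ` B) U}"

definition modification ::
  "'r set set \<Rightarrow> 'x::ab_group_add topology \<Rightarrow> ('r \<Rightarrow> 'x \<Rightarrow> 'x) \<Rightarrow> 'x topology" where
  "modification \<B> T act = topology (\<lambda>W.
     \<forall>w\<in>W. \<exists>U B. zero_nbhd T U \<and> B \<in> \<B> \<and> (+) w ` quot T act U B \<subseteq> W)"

text \<open>
  \<^const>\<open>topology\<close> is only meaningful on families that are closed under finite intersections and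
  arbitrary unions; the following lemmas confirm this, so that the open sets of
  \<^const>\<open>modification\<close> are the intended ones.
\<close>

lemma zero_nbhd_Int: "zero_nbhd T U \<Longrightarrow> zero_nbhd T V \<Longrightarrow> zero_nbhd T (U \<inter> V)"
  unfolding zero_nbhd_def by (metis IntI Int_mono openin_Int)

lemma quot_Int: "quot T act (U \<inter> U') (B \<union> B') \<subseteq> quot T act U B \<inter> quot T act U' B'"
proof -
  have "strongly_inside T A C"
    if "strongly_inside T A' C'" "A \<subseteq> A'" "C' \<subseteq> C" for A A' C C' :: "'a set"
    using that unfolding strongly_inside_def by (meson order_trans set_plus_mono2 order_refl)
  then show ?thesis
    unfolding quot_def image_Un by blast
qed

lemma (in ring_bornology) istopology_modification:
  "istopology (\<lambda>W. \<forall>w\<in>W. \<exists>U B. zero_nbhd T U \<and> B \<in> \<B> \<and> (+) w ` quot T act U B \<subseteq> W)"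
  (is "istopology ?P")
proof -
  have "?P (S \<inter> S')" if S: "?P S" and S': "?P S'" for S S'
  proof
    fix w assume w: "w \<in> S \<inter> S'"
    obtain U B where 1: "zero_nbhd T U" "B \<in> \<B>" "(+) w ` quot T act U B \<subseteq> S"
      using S w by blast
    obtain U' B' where 2: "zero_nbhd T U'" "B' \<in> \<B>" "(+) w ` quot T act U' B' \<subseteq> S'"
      using S' w by blast
    have "(+) w ` quot T act (U \<inter> U') (B \<union> B') \<subseteq> S \<inter> S'"
      using quot_Int[of T act U U' B B'] 1 2 by blast
    then show "\<exists>U B. zero_nbhd T U \<and> B \<in> \<B> \<and> (+) w ` quot T act U B \<subseteq> S \<inter> S'"
      using zero_nbhd_Int[OF 1(1) 2(1)] union_closed[OF 1(2) 2(2)] by blast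
  qed
  moreover have "?P (\<Union>K)" if "\<forall>S\<in>K. ?P S" for K
    using that by (meson UnionE Union_upper order_trans)
  ultimately show ?thesis
    unfolding istopology_def by blast
qed

lemma (in ring_bornology) openin_modification:
  "openin (modification \<B> T act) W \<longleftrightarrow>
     (\<forall>w\<in>W. \<exists>U B. zero_nbhd T U \<and> B \<in> \<B> \<and> (+) w ` quot T act U B \<subseteq> W)"
  unfolding modification_def topology_inverse'[OF istopology_modification] ..

end

theory Submission
  imports Defs
begin

text \<open>
  The sets \<open>U / B\<close> with \<open>U\<close> an open neighborhood of zero and \<open>B \<in> \<B>\<close> turn out to be open in the
  modified topology (\<open>openin_translate_quot\<close>), so their translates by \<open>w\<close> form a neighborhood base
  at \<open>w\<close>. Continuity into the modification therefore becomes an estimate for differences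
  (\<open>continuous_map_modificationI\<close>), and the inclusion \<open>V / B + V / B \<subseteq> U / B\<close> for \<open>V + V \<subseteq> U\<close>
  (\<open>quot_add\<close>) lets sums be estimated term by term. This settles the group operations; the
  modification is Hausdorff because it refines the original topology.

  For scalar multiplication one expands \<open>(r + s) (x + y) - r x = r y + s x + s y\<close> and makes
  each of the three terms lie in a given \<open>U / B\<close>. The term \<open>r y\<close> is small since
  \<open>B r \<in> \<B>\<close>. The term \<open>s x\<close> is small since \<open>B\<close> is bounded and \<open>t \<mapsto> t x\<close> is continuous. The term
  \<open>s y\<close>, in which both factors vary, is where local boundedness enters: if \<open>C W \<in> \<B>\<close> for
  \<open>C = B \<union> {1}\<close>, then \<open>s \<in> W\<close> and \<open>y \<in> U / (C W)\<close> already give \<open>s y \<in> U / B\<close>.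
\<close>

context left_module
begin

lemma act_zero_right [simp]: "act r 0 = 0"
  using act_right_distrib[of r 0 0] by simp

lemma act_zero_left [simp]: "act 0 x = 0"
  using act_left_distrib[of 0 0 x] by simp

lemma act_minus_right: "act r (- x) = - act r x"
  using act_right_distrib[of r x "- x"] by (simp add: add_eq_0_iff)

end

context topological_abelian_group
begin

lemma openin_vimage_add:
  assumes "openin T G"
  shows "openin T {z. x + z \<in> G}"
proof -
  have "continuous_map T (prod_topology T T) (\<lambda>z. (x, z))"
    by (simp add: continuous_map_pairwise o_def topspace_UNIV)
  then have "continuous_map T T ((\<lambda>(x, y). x + y) \<circ> (\<lambda>z. (x, z)))"
    using continuous_plus by (rule continuous_map_compose)
  then show ?thesis
    using openin_continuous_map_preimage[of T T "\<lambda>z. x + z" G] assms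
    by (simp add: o_def topspace_UNIV)
qed

lemma openin_vimage_uminus:
  assumes "openin T G"
  shows "openin T {z. - z \<in> G}"
  using openin_continuous_map_preimage[OF continuous_uminus assms] by (simp add: topspace_UNIV)

lemma zero_nbhd_half:
  assumes "openin T G" "0 \<in> G"
  obtains V where "openin T V" "0 \<in> V" "\<And>u v. u \<in> V \<Longrightarrow> v \<in> V \<Longrightarrow> u + v \<in> G"
proof -
  have "openin (prod_topology T T) {p. (\<lambda>(x, y). x + y) p \<in> G}"
    using openin_continuous_map_preimage[OF continuous_plus assms(1)] by (simp add: topspace_UNIV)
  then have "\<exists>U V. openin T U \<and> openin T V \<and> 0 \<in> U \<and> 0 \<in> V \<and> U \<times> V \<subseteq> {p. (\<lambda>(x, y). x + y) p \<in> G}"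
    using assms(2) unfolding openin_prod_topology_alt by (auto dest!: spec[of _ 0])
  then obtain U V where "openin T U" "openin T V" "0 \<in> U" "0 \<in> V"
    "U \<times> V \<subseteq> {p. (\<lambda>(x, y). x + y) p \<in> G}"
    by blast
  then show thesis
    by (intro that[of "U \<inter> V"]) auto
qed

end

lemma mem_quot_iff:
  "x \<in> quot T act U B \<longleftrightarrow>
     x \<in> U \<and> (\<exists>V. openin T V \<and> 0 \<in> V \<and> (\<forall>b\<in>B. \<forall>v\<in>V. act b x + v \<in> U))"
  unfolding quot_def strongly_inside_def zero_nbhd_def set_plus_def by (simp, blast)

lemma quot_mono: "U \<subseteq> U' \<Longrightarrow> B' \<subseteq> B \<Longrightarrow> quot T act U B \<subseteq> quot T act U' B'"
  unfolding mem_quot_iff subset_iff by meson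

text \<open>
  Since \<open>B (x + y) \<subseteq> B x + B y\<close>, a neighborhood \<open>N\<close> with \<open>B y + N \<subseteq> V'\<close> also serves the sum.
\<close>

lemma (in left_module) quot_add:
  assumes "x \<in> quot T act V B" "y \<in> quot T act V' B"
    and "\<And>u v. u \<in> V \<Longrightarrow> v \<in> V' \<Longrightarrow> u + v \<in> U"
  shows "x + y \<in> quot T act U B"
proof -
  obtain N where N: "openin T N" "0 \<in> N" "\<forall>b\<in>B. \<forall>v\<in>N. act b y + v \<in> V'"
    using assms(2) by (auto simp: mem_quot_iff)
  have x: "act b x \<in> V" if "b \<in> B" for b
    using assms(1) that by (force simp: mem_quot_iff)
  have "act b (x + y) + v \<in> U" if "b \<in> B" "v \<in> N" for b v
    using assms(3)[OF x[OF that(1)]] N that by (simp add: act_right_distrib add.assoc)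
  then show ?thesis
    using N assms by (auto simp: mem_quot_iff)
qed

locale modified_module =
  ring_bornology \<B> + semitopological_module T act
  for \<B> :: "'r::topological_ring set set"
    and T :: "'x::ab_group_add topology"
    and act :: "'r \<Rightarrow> 'x \<Rightarrow> 'x"
begin

abbreviation "Q \<equiv> quot T act"
abbreviation "T' \<equiv> modification \<B> T act"

lemma singleton_bornology: "{r} \<in> \<B>"
  using covers subset_closed by (metis UNIV_I UnionE empty_subsetI insert_subset)

lemma zero_mem_quot: "openin T U \<Longrightarrow> 0 \<in> U \<Longrightarrow> 0 \<in> Q U B"
  by (auto simp: mem_quot_iff)

text \<open>
  The set \<open>U / B\<close> is open for the modification: if \<open>B x + N \<subseteq> U\<close>, then \<open>x + N / B\<close> stays in \<open>U / B\<close>,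
  up to shrinking \<open>N\<close> so that also \<open>x + N \<subseteq> U\<close>. It is here that openness of \<open>U\<close> is used.
\<close>

lemma openin_translate_quot:
  assumes "openin T U" "B \<in> \<B>"
  shows "openin T' {z. z - w \<in> Q U B}"
  unfolding openin_modification
proof
  fix z assume "z \<in> {z. z - w \<in> Q U B}"
  then obtain N where N: "z - w \<in> U" "openin T N" "0 \<in> N"
    "\<forall>b\<in>B. \<forall>v\<in>N. act b (z - w) + v \<in> U"
    by (auto simp: mem_quot_iff)
  define M where "M = N \<inter> {v. (z - w) + v \<in> U}"
  have M: "openin T M" "0 \<in> M"
    using N assms(1) by (auto simp: M_def intro!: openin_Int openin_vimage_add)
  have "z + y - w \<in> Q U B" if y: "y \<in> Q M B" for y
  proof -
    obtain L where L: "y \<in> M" "openin T L" "0 \<in> L" "\<forall>b\<in>B. \<forall>v\<in>L. act b y + v \<in> M"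
      using y by (auto simp: mem_quot_iff)
    have "act b ((z - w) + y) + v \<in> U" if "b \<in> B" "v \<in> L" for b v
      using N(4) L(4) that by (simp add: act_right_distrib add.assoc M_def)
    then have "(z - w) + y \<in> Q U B"
      using L by (auto simp: mem_quot_iff M_def)
    then show ?thesis by (simp add: algebra_simps)
  qed
  then have "(+) z ` Q M B \<subseteq> {z. z - w \<in> Q U B}"
    by auto
  then show "\<exists>U' B'. zero_nbhd T U' \<and> B' \<in> \<B> \<and> (+) z ` Q U' B' \<subseteq> {z. z - w \<in> Q U B}"
    using M assms(2) unfolding zero_nbhd_def by blast
qed

lemma openin_modificationI:
  assumes "openin T W"
  shows "openin T' W"
  unfolding openin_modification
proof
  fix w assume "w \<in> W"
  then have "zero_nbhd T {z. w + z \<in> W}"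
    using openin_vimage_add[OF assms, of w] unfolding zero_nbhd_def by force
  moreover have "(+) w ` Q {z. w + z \<in> W} {1} \<subseteq> W"
    by (auto simp: mem_quot_iff)
  ultimately show "\<exists>U B. zero_nbhd T U \<and> B \<in> \<B> \<and> (+) w ` Q U B \<subseteq> W"
    using singleton_bornology by blast
qed

lemma topspace_modification: "topspace T' = UNIV"
  using openin_modificationI[of UNIV] openin_topspace[of T] openin_subset topspace_UNIV
  by fastforce

lemma Hausdorff_modification: "Hausdorff_space T'"
  using Hausdorff openin_modificationI
  unfolding Hausdorff_space_def topspace_modification topspace_UNIV by meson

lemma continuous_map_modificationI:
  assumes "\<And>x U B. x \<in> topspace X \<Longrightarrow> openin T U \<Longrightarrow> 0 \<in> U \<Longrightarrow> B \<in> \<B> \<Longrightarrow>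
    \<exists>G. openin X G \<and> x \<in> G \<and> (\<forall>y\<in>G. f y - f x \<in> Q U B)"
  shows "continuous_map X T' f"
  unfolding continuous_map
proof (intro conjI allI impI)
  fix W assume W: "openin T' W"
  have "\<exists>G. openin X G \<and> x \<in> G \<and> G \<subseteq> {x \<in> topspace X. f x \<in> W}"
    if x: "x \<in> topspace X" "f x \<in> W" for x
  proof -
    obtain U B where UB: "zero_nbhd T U" "B \<in> \<B>" "(+) (f x) ` Q U B \<subseteq> W"
      using W x(2) unfolding openin_modification by blast
    then obtain U' where U': "openin T U'" "0 \<in> U'" "U' \<subseteq> U"
      unfolding zero_nbhd_def by blast
    obtain G where G: "openin X G" "x \<in> G" "\<forall>y\<in>G. f y - f x \<in> Q U' B"
      using assms[OF x(1) U'(1,2) UB(2)] by blast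
    have "f y \<in> W" if "y \<in> G" for y
    proof -
      have "f x + (f y - f x) \<in> W"
        using G(3) that UB(3) quot_mono[OF U'(3) subset_refl] by blast
      then show ?thesis by simp
    qed
    then show ?thesis
      using G openin_subset by blast
  qed
  then show "openin X {x \<in> topspace X. f x \<in> W}"
    by (subst openin_subopen) blast
qed (simp add: topspace_modification)

lemma continuous_uminus_modification: "continuous_map T' T' uminus"
proof (rule continuous_map_modificationI)
  fix x :: 'x and U B assume U: "openin T U" "0 \<in> U" and B: "B \<in> \<B>"
  define V where "V = {z. - z \<in> U}"
  have V: "openin T V" "0 \<in> V"
    using U openin_vimage_uminus by (auto simp: V_def)
  have "- y - - x \<in> Q U B" if y: "y - x \<in> Q V B" for y
  proof -
    obtain N where N: "openin T N" "0 \<in> N" "\<forall>b\<in>B. \<forall>v\<in>N. act b (y - x) + v \<in> V"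
      using y by (auto simp: mem_quot_iff)
    have "act b (- (y - x)) + v \<in> U" if "b \<in> B" "- v \<in> N" for b v
      using N(3) that unfolding act_minus_right V_def by fastforce
    then have "- (y - x) \<in> Q U B"
      using y N openin_vimage_uminus[OF N(1)]
      by (auto simp: mem_quot_iff V_def intro!: exI[of _ "{v. - v \<in> N}"])
    then show ?thesis by simp
  qed
  then show "\<exists>G. openin T' G \<and> x \<in> G \<and> (\<forall>y\<in>G. - y - - x \<in> Q U B)"
    using openin_translate_quot[OF V(1) B, of x] zero_mem_quot[OF V, of B]
    by (intro exI[of _ "{y. y - x \<in> Q V B}"]) auto
qed

lemma continuous_plus_modification:
  "continuous_map (prod_topology T' T') T' (\<lambda>(x, y). x + y)"
proof (rule continuous_map_modificationI, clarify)
  fix x y U B assume U: "openin T U" "0 \<in> U" and B: "B \<in> \<B>"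
  obtain V where V: "openin T V" "0 \<in> V" "\<And>u v. u \<in> V \<Longrightarrow> v \<in> V \<Longrightarrow> u + v \<in> U"
    using zero_nbhd_half[OF U] by metis
  let ?G = "{z. z - x \<in> Q V B} \<times> {z. z - y \<in> Q V B}"
  have "x' + y' - (x + y) \<in> Q U B" if "x' - x \<in> Q V B" "y' - y \<in> Q V B" for x' y'
  proof -
    have "(x' - x) + (y' - y) \<in> Q U B"
      using that V(3) by (rule quot_add)
    then show ?thesis by (simp add: algebra_simps)
  qed
  moreover have "openin (prod_topology T' T') ?G"
    using openin_translate_quot[OF V(1) B] by (simp add: openin_prod_Times_iff)
  ultimately show "\<exists>G. openin (prod_topology T' T') G \<and> (x, y) \<in> G \<and>
      (\<forall>p\<in>G. (case p of (x, y) \<Rightarrow> x + y) - (x + y) \<in> Q U B)"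
    using zero_mem_quot[OF V(1,2), of B] by (intro exI[of _ ?G]) auto
qed

lemma scalar_mult_near_zero:
  assumes U: "openin T U" "0 \<in> U" and B: "B \<in> \<B>"
  obtains V C where "openin T V" "0 \<in> V" "C \<in> \<B>" "\<And>y. y \<in> Q V C \<Longrightarrow> act r y \<in> Q U B"
proof
  define V where "V = U \<inter> {y. act r y \<in> U}"
  have "openin T {y. act r y \<in> U}"
    using openin_continuous_map_preimage[OF continuous_act_right U(1)]
    by (simp add: topspace_UNIV)
  then show "openin T V" "0 \<in> V"
    using U by (auto simp: V_def)
  show "(\<lambda>b. b * r) ` B \<in> \<B>"
    by (rule right_mult_closed[OF B])
  show "act r y \<in> Q U B" if "y \<in> Q V ((\<lambda>b. b * r) ` B)" for y
    using that by (auto simp: mem_quot_iff V_def act_act)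
qed

text \<open>
  Halving \<open>U\<close> to \<open>V + V \<subseteq> U\<close> provides the room demanded by \<open>B (s x) \<Subset> U\<close>: it suffices that
  \<open>B (s x) \<subseteq> V\<close>, and boundedness yields a neighborhood \<open>W\<close> of zero with \<open>B W \<subseteq> {t. t x \<in> V}\<close>.
\<close>

lemma orbit_near_zero:
  assumes U: "openin T U" "0 \<in> U" and B: "B \<in> \<B>"
  obtains W where "open W" "0 \<in> W" "\<And>s. s \<in> W \<Longrightarrow> act s x \<in> Q U B"
proof -
  obtain V where V: "openin T V" "0 \<in> V" "\<And>u v. u \<in> V \<Longrightarrow> v \<in> V \<Longrightarrow> u + v \<in> U"
    using zero_nbhd_half[OF U] by metis
  have op: "open {t. act t x \<in> G}" if "openin T G" for G
    using openin_continuous_map_preimage[OF continuous_act_left that, of x] by simp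
  have "zero_nbhd euclidean {t. act t x \<in> V}"
    using op[OF V(1)] V(2) unfolding zero_nbhd_def by force
  then obtain W where W: "zero_nbhd euclidean W" "B * W \<subseteq> {t. act t x \<in> V}"
    using bounded[OF B] unfolding ring_bounded_def by meson
  then obtain W' where W': "open W'" "0 \<in> W'" "W' \<subseteq> W"
    unfolding zero_nbhd_def by auto
  show thesis
  proof
    show "open (W' \<inter> {t. act t x \<in> U})" "0 \<in> W' \<inter> {t. act t x \<in> U}"
      using W' op[OF U(1)] U(2) by auto
    show "act s x \<in> Q U B" if s: "s \<in> W' \<inter> {t. act t x \<in> U}" for s
    proof -
      have "act b (act s x) \<in> V" if "b \<in> B" for b
        using W(2) W'(3) s that set_times_intro[of b B s W] by (auto simp: act_act)
      then show ?thesis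
        using s V by (auto simp: mem_quot_iff)
    qed
  qed
qed

text \<open>
  Adjoining 1 to \<open>B\<close> before applying local boundedness gives the membership \<open>s y \<in> U\<close> that belongs
  to \<open>s y \<in> U / B\<close>, because \<open>W\<close> itself is then contained in the product set.
\<close>

lemma product_near_zero:
  assumes lb: "locally_bounded \<B>" and U: "openin T U" "0 \<in> U" and B: "B \<in> \<B>"
  obtains W C where "open W" "0 \<in> W" "C \<in> \<B>"
    "\<And>s y. s \<in> W \<Longrightarrow> y \<in> Q U C \<Longrightarrow> act s y \<in> Q U B"
proof -
  have "B \<union> {1} \<in> \<B>"
    using union_closed[OF B singleton_bornology] .
  then obtain W where W: "zero_nbhd euclidean W" "(B \<union> {1}) * W \<in> \<B>"
    using lb unfolding locally_bounded_def by blast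
  then obtain W' where W': "open W'" "0 \<in> W'" "W' \<subseteq> W"
    unfolding zero_nbhd_def by auto
  have "act s y \<in> Q U B" if s: "s \<in> W'" and y: "y \<in> Q U ((B \<union> {1}) * W)" for s y
  proof -
    obtain N where N: "openin T N" "0 \<in> N"
      "\<forall>c\<in>(B \<union> {1}) * W. \<forall>v\<in>N. act c y + v \<in> U"
      using y by (auto simp: mem_quot_iff)
    have c: "act b (act s y) + v \<in> U" if "b \<in> B \<union> {1}" "v \<in> N" for b v
      using N(3) set_times_intro[OF that(1), of s W] s W'(3) that(2) by (auto simp: act_act)
    then show ?thesis
      using c[of 1 0] N by (auto simp: mem_quot_iff act_one)
  qed
  then show thesis
    using that W' W(2) by blast
qed

lemma continuous_act_modification:
  assumes lb: "locally_bounded \<B>"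
  shows "continuous_map (prod_topology euclidean T') T' (\<lambda>(r, x). act r x)"
proof (rule continuous_map_modificationI, clarify)
  fix r x U B assume U: "openin T U" "0 \<in> U" and B: "B \<in> \<B>"
  \<comment> \<open>Three error terms have to fit into \<open>U\<close>, hence two halvings.\<close>
  obtain V where V: "openin T V" "0 \<in> V" "\<And>u v. u \<in> V \<Longrightarrow> v \<in> V \<Longrightarrow> u + v \<in> U"
    using zero_nbhd_half[OF U] by metis
  obtain V' where V': "openin T V'" "0 \<in> V'" "\<And>u v. u \<in> V' \<Longrightarrow> v \<in> V' \<Longrightarrow> u + v \<in> V"
    using zero_nbhd_half[OF V(1,2)] by metis
  obtain V1 C1 where 1: "openin T V1" "0 \<in> V1" "C1 \<in> \<B>"
    "\<And>y. y \<in> Q V1 C1 \<Longrightarrow> act r y \<in> Q V B"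
    using scalar_mult_near_zero[OF V(1,2) B] by blast
  obtain W2 where 2: "open W2" "0 \<in> W2" "\<And>s. s \<in> W2 \<Longrightarrow> act s x \<in> Q V' B"
    using orbit_near_zero[OF V'(1,2) B] by blast
  obtain W3 C3 where 3: "open W3" "0 \<in> W3" "C3 \<in> \<B>"
    "\<And>s y. s \<in> W3 \<Longrightarrow> y \<in> Q V' C3 \<Longrightarrow> act s y \<in> Q V' B"
    using product_near_zero[OF lb V'(1,2) B] by blast
  \<comment> \<open>Writing \<open>- r + t\<close> instead of \<open>t - r\<close> reduces continuity in \<open>t\<close> to that of addition.\<close>
  let ?S = "{t. - r + t \<in> W2 \<inter> W3}" and ?Y = "{z. z - x \<in> Q (V1 \<inter> V') (C1 \<union> C3)}"
  have "continuous_on UNIV (\<lambda>t. - r + t)"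
    by (intro continuous_on_add continuous_on_const continuous_on_id)
  then have "open ?S"
    using open_vimage[of "W2 \<inter> W3" "\<lambda>t. - r + t"] 2(1) 3(1) by (simp add: vimage_def open_Int)
  moreover have "openin T' ?Y"
    using 1 3 V' by (intro openin_translate_quot union_closed) auto
  ultimately have "openin (prod_topology euclidean T') (?S \<times> ?Y)"
    by (simp add: openin_prod_Times_iff)
  moreover have "act t z - act r x \<in> Q U B" if t: "t \<in> ?S" and z: "z \<in> ?Y" for t z
  proof -
    define s y where "s = - r + t" and "y = z - x"
    have y: "y \<in> Q V1 C1" "y \<in> Q V' C3"
      using z quot_Int[of T act V1 V' C1 C3] by (auto simp: y_def)
    have s: "s \<in> W2" "s \<in> W3"
      using t by (auto simp: s_def)
    have "act s x + act s y \<in> Q V B"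
      using 2(3)[OF s(1)] 3(4)[OF s(2) y(2)] V'(3) by (rule quot_add)
    then have "act r y + (act s x + act s y) \<in> Q U B"
      using quot_add[OF 1(4)[OF y(1)] _ V(3)] by blast
    moreover have "t = r + s" "z = x + y"
      by (simp_all add: s_def y_def)
    then have "act t z - act r x = act r y + (act s x + act s y)"
      by (simp add: act_left_distrib act_right_distrib)
    ultimately show ?thesis by simp
  qed
  moreover have "(r, x) \<in> ?S \<times> ?Y"
    using zero_mem_quot[of "V1 \<inter> V'" "C1 \<union> C3"] 1 2 3 V' by auto
  ultimately show "\<exists>G. openin (prod_topology euclidean T') G \<and> (r, x) \<in> G \<and>
      (\<forall>p\<in>G. (case p of (r, x) \<Rightarrow> act r x) - act r x \<in> Q U B)"
    by (intro exI[of _ "?S \<times> ?Y"]) auto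
qed

end

theorem theorem5p4:
  fixes \<B> :: "'r::topological_ring set set"
    and T :: "'x::ab_group_add topology"
    and act :: "'r \<Rightarrow> 'x \<Rightarrow> 'x"
  assumes "ring_bornology \<B>"
    and "locally_bounded \<B>"
    and "semitopological_module T act"
  shows "topological_module (modification \<B> T act) act"
proof -
  interpret modified_module \<B> T act
    using assms by (simp add: modified_module_def)
  show ?thesis
    by unfold_locales
      (fact topspace_modification continuous_plus_modification continuous_uminus_modification
        Hausdorff_modification continuous_act_modification[OF assms(2)])+
qed

end
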